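(* Let $f(z)=\sum_{k\ge0}\frac{\xi_k}{\sqrt{k!}}z^k$ be the standard planar Gaussian analytic function. With $\alpha_k$ and $P_k$ as defined in the context, almost surely $$\frac1{\sqrt{k!}}\,\frac{\xi_k}{\xi_0}=(-1)^kP_k(\alpha_1,\alpha_2,\dots,\alpha_k)\qquad\text{for each }k\ge1.$$
   Context: $(\xi_k)_{k\ge0}$ are i.i.d. standard complex Gaussians. Let $f_n(z)=\sum_{k=0}^n\frac{\xi_k}{\sqrt{k!}}z^k$, $\mathcal{Z}_n$ its zero set, and $\alpha_k(n)=\sum_{z\in\mathcal{Z}_n}\frac1{z^k}$ for $k\ge1$. For each $k$ the random variables $\alpha_k(n)$ converge in probability as $n\to\infty$; $\alpha_k$ denotes the limit (the analogue of the sum $\sum 1/z^k$ over the zeroes of $f$). $P_k$ is the Newton polynomial of degree $k$: the polynomial, with coefficients depending only on $k$, such that $e_k(z_1,\dots,z_N)=P_k(\beta_1,\dots,\beta_k)$, where $e_k$ is the elementary symmetric polynomial of order $k$ and $\beta_i=\sum_{j=1}^Nz_j^i$. *)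

theory Defs
  imports "HOL-Probability.Probability" "HOL-Library.Poly_Mapping"
begin

section \<open>Newton polynomials\<close>

definition elem_sym :: "nat \<Rightarrow> nat \<Rightarrow> (nat \<Rightarrow> complex) \<Rightarrow> complex" where
  "elem_sym k N z = (\<Sum>A | A \<subseteq> {1..N} \<and> card A = k. \<Prod>j\<in>A. z j)"

text \<open>
  A polynomial in variables indexed by \<^typ>\<open>nat\<close> is a finitely supported map from monomials,
  themselves finitely supported exponent vectors, to coefficients.
\<close>

definition eval_mpoly :: "((nat \<Rightarrow>\<^sub>0 nat) \<Rightarrow>\<^sub>0 complex) \<Rightarrow> (nat \<Rightarrow> complex) \<Rightarrow> complex" where
  "eval_mpoly p x =
     (\<Sum>m\<in>Poly_Mapping.keys p. Poly_Mapping.lookup p m *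
        (\<Prod>i\<in>Poly_Mapping.keys m. x i ^ Poly_Mapping.lookup m i))"

text \<open>
  The polynomial does not depend on the number \<open>N\<close> of points, and only the variables
  \<open>1, \<dots>, k\<close> may occur in it.
\<close>

definition is_newton_poly :: "nat \<Rightarrow> ((nat \<Rightarrow>\<^sub>0 nat) \<Rightarrow>\<^sub>0 complex) \<Rightarrow> bool" where
  "is_newton_poly k p \<longleftrightarrow>
     (\<forall>m\<in>Poly_Mapping.keys p. Poly_Mapping.keys m \<subseteq> {1..k}) \<and>
     (\<forall>N z. elem_sym k N z = eval_mpoly p (\<lambda>i. \<Sum>j=1..N. z j ^ i))"

text \<open>
  There is exactly one such polynomial, because for \<open>N \<ge> k\<close> every point of
  $\mathbb{C}^k$ is the vector of the first \<open>k\<close> power sums of some \<open>z\<close>.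
\<close>

definition newton_poly :: "nat \<Rightarrow> (nat \<Rightarrow>\<^sub>0 nat) \<Rightarrow>\<^sub>0 complex" where
  "newton_poly k = (SOME p. is_newton_poly k p)"


section \<open>Convergence in probability\<close>

definition tendsto_in_prob ::
    "'a measure \<Rightarrow> (nat \<Rightarrow> 'a \<Rightarrow> complex) \<Rightarrow> ('a \<Rightarrow> complex) \<Rightarrow> bool" where
  "tendsto_in_prob M X Y \<longleftrightarrow>
     (\<forall>n. X n \<in> borel_measurable M) \<and> Y \<in> borel_measurable M \<and>
     (\<forall>\<epsilon>>0. (\<lambda>n. measure M {\<omega> \<in> space M. dist (X n \<omega>) (Y \<omega>) > \<epsilon>}) \<longlonglongrightarrow> 0)"

text \<open>The limit is determined only up to almost sure equality; some version of it is chosen.\<close>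

definition lim_in_prob :: "'a measure \<Rightarrow> (nat \<Rightarrow> 'a \<Rightarrow> complex) \<Rightarrow> 'a \<Rightarrow> complex" where
  "lim_in_prob M X = (SOME Y. tendsto_in_prob M X Y)"


section \<open>The planar Gaussian analytic function\<close>

text \<open>The standard complex Gaussian has density $e^{-|z|^2}/\pi$ on the plane.\<close>

definition std_complex_gaussian :: "'a measure \<Rightarrow> ('a \<Rightarrow> complex) \<Rightarrow> bool" where
  "std_complex_gaussian M X \<longleftrightarrow>
     distributed M lborel X (\<lambda>z. ennreal (exp (- (cmod z)\<^sup>2) / pi))"

text \<open>In the following, \<open>c\<close> is one realisation of the sequence of Gaussian coefficients.\<close>

definition gaf_trunc :: "(nat \<Rightarrow> complex) \<Rightarrow> nat \<Rightarrow> complex \<Rightarrow> complex" where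
  "gaf_trunc c n z = (\<Sum>k\<le>n. c k / of_real (sqrt (fact k)) * z ^ k)"

definition gaf_zeros :: "(nat \<Rightarrow> complex) \<Rightarrow> nat \<Rightarrow> complex set" where
  "gaf_zeros c n = {z. gaf_trunc c n z = 0}"

text \<open>
  The exceptional realisations in which \<open>0\<close> is a zero (where \<open>1 / 0 = 0\<close>), the truncation
  vanishes identically (where the infinite sum is \<open>0\<close>) or a zero is multiple have probability
  \<open>0\<close>.
\<close>

definition inv_power_sum :: "(nat \<Rightarrow> complex) \<Rightarrow> nat \<Rightarrow> nat \<Rightarrow> complex" where
  "inv_power_sum c n k = (\<Sum>z\<in>gaf_zeros c n. 1 / z ^ k)"

text \<open>
  The limit is taken over the completed probability space, on which a function that agrees almost
  surely with a random variable is itself a random variable.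
\<close>

definition gaf_alpha :: "'a measure \<Rightarrow> (nat \<Rightarrow> 'a \<Rightarrow> complex) \<Rightarrow> nat \<Rightarrow> 'a \<Rightarrow> complex" where
  "gaf_alpha M \<xi> k = lim_in_prob (completion M) (\<lambda>n \<omega>. inv_power_sum (\<lambda>j. \<xi> j \<omega>) n k)"

end

(*
  If f_n has simple zeros, none of them at 0, then f_n(X) = f_n(0) * prod (1 - X/z) over its zeros.
  Logarithmic differentiation shows that the inverse power sum of order k is determined by the
  coefficients 0, ..., min(k,n) of f_n.  Hence alpha_k(n) does not depend on n once n >= k, so
  alpha_k = alpha_k(k) almost surely, and the claim is Vieta's formula for f_k.  The zeros are almost
  surely simple because, conditionally on the other coefficients, xi_0 has no atoms and only finitely
  many of its values produce a multiple zero.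
*)

theory Submission
  imports Defs "HOL-Computational_Algebra.Fundamental_Theorem_Algebra" "HOL-Computational_Algebra.Polynomial_FPS"
begin

section \<open>Newton's identities and Vieta's formula as identities of formal power series\<close>

text \<open>Logarithmic differentiation: the factor 1 - w X contributes -w / (1 - w X), a geometric
  series, and the contributions of the factors add up.\<close>

lemma fps_deriv_prod_linear:
  fixes w :: "'b \<Rightarrow> complex"
  assumes "finite A"
  shows "fps_deriv (\<Prod>j\<in>A. 1 - fps_const (w j) * fps_X)
    = - (\<Prod>j\<in>A. 1 - fps_const (w j) * fps_X) * Abs_fps (\<lambda>m. \<Sum>j\<in>A. w j ^ Suc m)"
  using assms
proof (induction A rule: finite_induct)
  case empty
  then show ?case by (simp add: fps_eq_iff)
next
  case (insert j A)
  let ?L = "1 - fps_const (w j) * fps_X :: complex fps"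
  let ?E = "\<Prod>j\<in>A. 1 - fps_const (w j) * fps_X :: complex fps"
  let ?B = "\<lambda>A. Abs_fps (\<lambda>m. \<Sum>j\<in>A. w j ^ Suc m)"
  have split: "?B (insert j A) = Abs_fps (\<lambda>m. w j ^ Suc m) + ?B A"
    using insert by (simp add: fps_eq_iff)
  have geometric: "?L * Abs_fps (\<lambda>m. w j ^ Suc m) = fps_const (w j)"
    by (rule fps_ext) (auto simp: left_diff_distrib mult.assoc gr0_conv_Suc split: nat.split)
  have "fps_deriv (?L * ?E) = - fps_const (w j) * ?E + ?L * (- ?E * ?B A)"
    using insert.IH by simp
  also have "\<dots> = - (?L * ?E) * ?B (insert j A)"
  proof -
    have "- c * E + L * (- E * B) = - (L * E) * (G + B)" if "L * G = c" for c E L G B :: "complex fps"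
      unfolding that[symmetric] by (simp add: algebra_simps)
    from this[OF geometric] show ?thesis
      unfolding split .
  qed
  finally show ?case using insert.hyps by simp
qed

text \<open>Newton's identities, read off by comparing the coefficients of X^m in the logarithmic
  derivative. No relation between m and the size of \<open>A\<close> is imposed, so one recursion
  serves all orders.\<close>

lemma fps_nth_prod_linear_Suc:
  fixes w :: "'b \<Rightarrow> complex"
  assumes "finite A"
  defines "E \<equiv> (\<Prod>j\<in>A. 1 - fps_const (w j) * fps_X)"
  shows "of_nat (Suc m) * fps_nth E (Suc m)
    = - (\<Sum>i\<le>m. fps_nth E i * (\<Sum>j\<in>A. w j ^ (Suc m - i)))"
proof -
  have deriv: "fps_deriv E = - (E * Abs_fps (\<lambda>m. \<Sum>j\<in>A. w j ^ Suc m))"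
    unfolding E_def fps_deriv_prod_linear[OF assms(1)] by (rule mult_minus_left)
  have "of_nat (Suc m) * fps_nth E (Suc m) = fps_nth (fps_deriv E) m"
    by (simp only: fps_deriv_nth Suc_eq_plus1)
  also have "\<dots> = - (\<Sum>i=0..m. fps_nth E i * (\<Sum>j\<in>A. w j ^ Suc (m - i)))"
    by (simp only: deriv fps_neg_nth fps_mult_nth fps_nth_Abs_fps)
  also have "\<dots> = - (\<Sum>i\<le>m. fps_nth E i * (\<Sum>j\<in>A. w j ^ (Suc m - i)))"
    unfolding atMost_atLeast0 by (intro arg_cong[of _ _ uminus] sum.cong refl) (simp add: Suc_diff_le)
  finally show ?thesis .
qed

lemma fps_nth_prod_linear_0:
  fixes w :: "'b \<Rightarrow> complex"
  shows "fps_nth (\<Prod>j\<in>A. 1 - fps_const (w j) * fps_X) 0 = 1"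
  by (induction A rule: infinite_finite_induct) auto

text \<open>Expanding the product means choosing the set \<open>B\<close> of factors that contribute
  -z X; the power of X that results is the cardinality of \<open>B\<close>.\<close>

lemma fps_nth_prod_linear_elem_sym:
  "fps_nth (\<Prod>j\<in>{1..N}. 1 - fps_const (z j) * fps_X) k = (-1) ^ k * elem_sym k N z"
proof -
  have "(\<Prod>j\<in>{1..N}. 1 - fps_const (z j) * fps_X)
      = (\<Prod>j\<in>{1..N}. fps_const (- z j) * fps_X + 1)"
    by (intro prod.cong refl) (simp add: fps_const_neg[symmetric] del: fps_const_neg)
  also have "\<dots> = (\<Sum>B\<in>Pow {1..N}. fps_const (\<Prod>j\<in>B. - z j) * fps_X ^ card B)"
  proof -
    have "(\<Prod>j\<in>B. fps_const (- z j)) = fps_const (\<Prod>j\<in>B. - z j)" for B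
      by (induction B rule: infinite_finite_induct) (simp_all flip: fps_const_mult)
    then show ?thesis
      by (simp add: prod_add prod.distrib del: fps_const_neg)
  qed
  also have "fps_nth \<dots> k = (\<Sum>B\<in>Pow {1..N}. if card B = k then (\<Prod>j\<in>B. - z j) else 0)"
    unfolding fps_sum_nth by (intro sum.cong) (auto simp: fps_X_power_iff)
  also have "\<dots> = (\<Sum>B | B \<subseteq> {1..N} \<and> card B = k. (\<Prod>j\<in>B. - z j))"
    by (subst sum.inter_filter[symmetric]) (auto simp: Pow_def)
  also have "\<dots> = (-1) ^ k * elem_sym k N z"
    unfolding elem_sym_def sum_distrib_left by (intro sum.cong) (auto simp: prod_uminus)
  finally show ?thesis .
qed

section \<open>Existence of the Newton polynomials\<close>

definition monomial_val :: "(nat \<Rightarrow>\<^sub>0 nat) \<Rightarrow> (nat \<Rightarrow> complex) \<Rightarrow> complex" where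
  "monomial_val m x = (\<Prod>i\<in>Poly_Mapping.keys m. x i ^ Poly_Mapping.lookup m i)"

lemma monomial_val_superset:
  assumes "finite S" "Poly_Mapping.keys m \<subseteq> S"
  shows "monomial_val m x = (\<Prod>i\<in>S. x i ^ Poly_Mapping.lookup m i)"
  unfolding monomial_val_def using assms
  by (intro prod.mono_neutral_left) (auto simp: in_keys_iff)

lemma monomial_val_add: "monomial_val (m + m') x = monomial_val m x * monomial_val m' x"
proof -
  let ?S = "Poly_Mapping.keys m \<union> Poly_Mapping.keys m'"
  have "Poly_Mapping.keys (m + m') \<subseteq> ?S"
    by (rule Poly_Mapping.keys_add)
  then show ?thesis
    by (simp add: monomial_val_superset[of ?S] lookup_add power_add prod.distrib)
qed

lemma monomial_val_single: "monomial_val (Poly_Mapping.single i 1) x = x i"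
  by (simp add: monomial_val_def)

text \<open>Additional monomials have coefficient 0. A common index set is what makes sums
  comparable, since cancellation can make the keys of \<open>p + q\<close> fewer than those of
  \<open>p\<close> and \<open>q\<close> together.\<close>

lemma eval_mpoly_superset:
  assumes "finite S" "Poly_Mapping.keys p \<subseteq> S"
  shows "eval_mpoly p x = (\<Sum>m\<in>S. Poly_Mapping.lookup p m * monomial_val m x)"
  unfolding eval_mpoly_def monomial_val_def[symmetric] using assms
  by (intro sum.mono_neutral_left) (auto simp: in_keys_iff)

lemma eval_mpoly_add: "eval_mpoly (p + q) x = eval_mpoly p x + eval_mpoly q x"
proof -
  let ?S = "Poly_Mapping.keys p \<union> Poly_Mapping.keys q"
  have "Poly_Mapping.keys (p + q) \<subseteq> ?S"
    by (rule Poly_Mapping.keys_add)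
  then show ?thesis
    by (simp add: eval_mpoly_superset[of ?S] lookup_add algebra_simps sum.distrib)
qed

lemma eval_mpoly_single: "eval_mpoly (Poly_Mapping.single m c) x = c * monomial_val m x"
  by (cases "c = 0") (simp_all add: eval_mpoly_def monomial_val_def)

lemma eval_mpoly_cong:
  assumes "\<And>m i. m \<in> Poly_Mapping.keys p \<Longrightarrow> i \<in> Poly_Mapping.keys m \<Longrightarrow> x i = y i"
  shows "eval_mpoly p x = eval_mpoly p y"
  unfolding eval_mpoly_def using assms by (intro sum.cong prod.cong arg_cong2[of _ _ _ _ "(*)"]) auto

text \<open>Only the existence of a representing polynomial matters, so the closure properties are
  proved for functions; products of coefficient maps never have to be formed.\<close>

definition polynomial_funs :: "nat set \<Rightarrow> ((nat \<Rightarrow> complex) \<Rightarrow> complex) set" where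
  "polynomial_funs K = {eval_mpoly p | p. \<forall>m\<in>Poly_Mapping.keys p. Poly_Mapping.keys m \<subseteq> K}"

lemma polynomial_funs_mono: "K \<subseteq> L \<Longrightarrow> polynomial_funs K \<subseteq> polynomial_funs L"
  unfolding polynomial_funs_def by blast

lemma polynomial_funs_monomial:
  assumes "Poly_Mapping.keys m \<subseteq> K"
  shows "(\<lambda>x. c * monomial_val m x) \<in> polynomial_funs K"
  unfolding polynomial_funs_def using assms
  by (auto simp: eval_mpoly_single intro!: exI[of _ "Poly_Mapping.single m c"]
      split: if_splits)

lemma polynomial_funs_add:
  assumes "F \<in> polynomial_funs K" "G \<in> polynomial_funs K"
  shows "(\<lambda>x. F x + G x) \<in> polynomial_funs K"
proof -
  obtain p q where "F = eval_mpoly p" "\<forall>m\<in>Poly_Mapping.keys p. Poly_Mapping.keys m \<subseteq> K"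
    "G = eval_mpoly q" "\<forall>m\<in>Poly_Mapping.keys q. Poly_Mapping.keys m \<subseteq> K"
    using assms unfolding polynomial_funs_def by blast
  moreover have "Poly_Mapping.keys (p + q) \<subseteq> Poly_Mapping.keys p \<union> Poly_Mapping.keys q"
    by (rule Poly_Mapping.keys_add)
  ultimately show ?thesis
    unfolding polynomial_funs_def by (auto simp: eval_mpoly_add intro!: exI[of _ "p + q"])
qed

lemma polynomial_funs_const: "(\<lambda>x. c) \<in> polynomial_funs K"
  using polynomial_funs_monomial[of 0 K c] by (simp add: monomial_val_def)

lemma polynomial_funs_sum:
  assumes "\<And>i. i \<in> I \<Longrightarrow> F i \<in> polynomial_funs K"
  shows "(\<lambda>x. \<Sum>i\<in>I. F i x) \<in> polynomial_funs K"
  using assms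
  by (induction I rule: infinite_finite_induct) (auto intro: polynomial_funs_const polynomial_funs_add)

text \<open>Multiplication by one variable raises one exponent in each monomial. This and addition
  are the only operations in Newton's recursion.\<close>

lemma polynomial_funs_mult_var:
  assumes "F \<in> polynomial_funs K" "i \<in> K"
  shows "(\<lambda>x. c * x i * F x) \<in> polynomial_funs K"
proof -
  obtain p where F: "F = eval_mpoly p" and p: "\<forall>m\<in>Poly_Mapping.keys p. Poly_Mapping.keys m \<subseteq> K"
    using assms unfolding polynomial_funs_def by blast
  have "(\<lambda>x. c * x i * F x) = (\<lambda>x. \<Sum>m\<in>Poly_Mapping.keys p.
      c * Poly_Mapping.lookup p m * monomial_val (m + Poly_Mapping.single i 1) x)"
    unfolding F eval_mpoly_superset[OF finite_keys order_refl] monomial_val_add monomial_val_single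
    by (simp add: sum_distrib_left mult_ac)
  also have "\<dots> \<in> polynomial_funs K"
  proof (intro polynomial_funs_sum polynomial_funs_monomial)
    fix m assume "m \<in> Poly_Mapping.keys p"
    then show "Poly_Mapping.keys (m + Poly_Mapping.single i 1) \<subseteq> K"
      using p assms(2) Poly_Mapping.keys_add[of m "Poly_Mapping.single i 1"] by auto
  qed
  finally show ?thesis .
qed

text \<open>Strong induction on the order: Newton's identity expresses e_k through e_0, ..., e_(k-1)
  and power sums. The function is chosen before the number of points, which makes it independent of
  \<open>N\<close>.\<close>

lemma elem_sym_polynomial_in_power_sums:
  "\<exists>F\<in>polynomial_funs {1..k}. \<forall>N z. elem_sym k N z = F (\<lambda>i. \<Sum>j=1..N. z j ^ i)"
proof (induction k rule: less_induct)
  case (less k)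
  show ?case
  proof (cases k)
    case 0
    have "{A. A \<subseteq> {1..N} \<and> card A = 0} = {{}}" for N :: nat
      by (auto dest: finite_subset)
    then have "elem_sym 0 N z = 1" for N z
      by (simp add: elem_sym_def)
    then show ?thesis
      using 0 polynomial_funs_const[of 1 "{1..k}"] by (auto intro!: bexI[of _ "\<lambda>x. 1"])
  next
    case (Suc m)
    have "\<forall>i\<in>{..m}. \<exists>F. F \<in> polynomial_funs {1..i} \<and>
        (\<forall>N z. elem_sym i N z = F (\<lambda>i. \<Sum>j=1..N. z j ^ i))"
      using less.IH Suc by (auto simp: Bex_def)
    from bchoice[OF this] obtain F where F: "\<And>i. i \<le> m \<Longrightarrow> F i \<in> polynomial_funs {1..i}"
      "\<And>i N z. i \<le> m \<Longrightarrow> elem_sym i N z = F i (\<lambda>i. \<Sum>j=1..N. z j ^ i)"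
      by auto
    \<comment> \<open>Newton's identity solved for e_k: the coefficient of X^i is (-1)^i e_i, and
      the sign (-1)^k changes sides because its square is 1. As i < k, the variable of index 0 does
      not occur.\<close>
    define G where "G = (\<lambda>x. \<Sum>i\<le>m. - ((-1) ^ i * (-1) ^ k / of_nat k) * x (k - i) * F i x)"
    have "G \<in> polynomial_funs {1..k}"
      unfolding G_def
    proof (intro polynomial_funs_sum polynomial_funs_mult_var)
      fix i assume "i \<in> {..m}"
      then show "F i \<in> polynomial_funs {1..k}" "k - i \<in> {1..k}"
        using F(1)[of i] polynomial_funs_mono[of "{1..i}" "{1..k}"] Suc by auto
    qed
    moreover have "elem_sym k N z = G (\<lambda>i. \<Sum>j=1..N. z j ^ i)" for N z
    proof -
      have sq: "(-1) ^ k * (-1) ^ k = (1::complex)"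
        by (simp flip: power_mult_distrib)
      have "of_nat k * ((-1) ^ k * elem_sym k N z)
          = - (\<Sum>i\<le>m. (-1) ^ i * elem_sym i N z * (\<Sum>j=1..N. z j ^ (k - i)))"
        using fps_nth_prod_linear_Suc[OF finite_atLeastAtMost[of 1 N], where w = z and m = m]
        by (simp only: fps_nth_prod_linear_elem_sym Suc)
      then have "(-1) ^ k * (of_nat k * ((-1) ^ k * elem_sym k N z)) / of_nat k
          = (-1) ^ k * (- (\<Sum>i\<le>m. (-1) ^ i * elem_sym i N z * (\<Sum>j=1..N. z j ^ (k - i)))) / of_nat k"
        by simp
      moreover have "(-1) ^ k * (of_nat k * ((-1) ^ k * elem_sym k N z)) / of_nat k = elem_sym k N z"
        using sq Suc by (simp add: mult.left_commute mult.assoc[symmetric] del: of_nat_Suc)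
      moreover have "(-1) ^ k * (- (\<Sum>i\<le>m. (-1) ^ i * elem_sym i N z * (\<Sum>j=1..N. z j ^ (k - i)))) / of_nat k
          = G (\<lambda>i. \<Sum>j=1..N. z j ^ i)"
        unfolding G_def sum_negf[symmetric] sum_distrib_left[of _ _ "{..m}"] sum_divide_distrib[of _ "{..m}"]
        by (intro sum.cong refl) (simp add: F(2))
      ultimately show ?thesis by simp
    qed
    ultimately show ?thesis by blast
  qed
qed

lemma is_newton_poly_newton_poly: "is_newton_poly k (newton_poly k)"
  unfolding newton_poly_def
proof (rule someI_ex)
  show "\<exists>p. is_newton_poly k p"
    using elem_sym_polynomial_in_power_sums[of k]
    unfolding is_newton_poly_def polynomial_funs_def by blast
qed

section \<open>Inverse power sums of the zeros in terms of the coefficients\<close>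

text \<open>
  Newton's identities solved for the power sums of the reciprocals of the zeros of
  $\sum_k a_k z^k$.
\<close>

function newton_sum :: "(nat \<Rightarrow> complex) \<Rightarrow> nat \<Rightarrow> complex" where
  "newton_sum a m
     = - (of_nat m * a m + (\<Sum>i=1..<m. a i * newton_sum a (m - i))) / a 0"
  by auto
termination by (relation "Wellfounded.measure snd") auto

declare newton_sum.simps [simp del]

text \<open>The recursion for order m reads no coefficient beyond m. This is why the inverse power
  sums stop changing once the degree of the truncation reaches m.\<close>

lemma newton_sum_cong:
  assumes "\<And>i. i \<le> m \<Longrightarrow> a i = b i"
  shows "newton_sum a m = newton_sum b m"
  using assms
proof (induction m rule: less_induct)
  case (less m)
  then have "newton_sum a (m - i) = newton_sum b (m - i)" if "i \<in> {1..<m}" for i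
    using that by auto
  with less.prems show ?case
    unfolding newton_sum.simps[of a m] newton_sum.simps[of b m] by (auto intro!: sum.cong)
qed

text \<open>Newton's identities are triangular with \<open>a 0\<close> on the diagonal, so they
  determine \<open>s\<close> from order 1 on; \<open>s 0\<close> never enters.\<close>

lemma newton_sum_unique:
  assumes "a 0 \<noteq> 0"
    and "\<And>m. of_nat (Suc m) * a (Suc m) = - (\<Sum>i\<le>m. a i * s (Suc m - i))"
    and "m \<ge> 1"
  shows "newton_sum a m = s m"
  using assms(3)
proof (induction m rule: less_induct)
  case (less m)
  then obtain l where m: "m = Suc l"
    by (cases m) auto
  \<comment> \<open>The term i = 0 carries the unknown \<open>s m\<close>; the others involve
    smaller positive orders and fall under the induction hypothesis.\<close>
  have "(\<Sum>i\<le>l. a i * s (m - i)) = a 0 * s m + (\<Sum>i=1..<m. a i * s (m - i))"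
    unfolding m lessThan_Suc_atMost[symmetric] lessThan_atLeast0
    by (subst sum.atLeast_Suc_lessThan) auto
  moreover have "(\<Sum>i=1..<m. a i * s (m - i)) = (\<Sum>i=1..<m. a i * newton_sum a (m - i))"
    using less by (intro sum.cong) auto
  ultimately show ?case
    using assms(2)[of l] assms(1) unfolding newton_sum.simps[of a m]
    by (simp add: m field_simps del: of_nat_Suc)
qed

text \<open>Measurability of the inverse power sums is obtained from this formula in the
  coefficients, which avoids a measurable enumeration of the zeros.\<close>

lemma measurable_newton_sum:
  assumes [measurable]: "\<And>i. X i \<in> borel_measurable M"
  shows "(\<lambda>\<omega>. newton_sum (\<lambda>i. X i \<omega>) m) \<in> borel_measurable M"
proof (induction m rule: less_induct)
  case (less m)
  have "(\<lambda>\<omega>. \<Sum>i=1..<m. X i \<omega> * newton_sum (\<lambda>i. X i \<omega>) (m - i)) \<in> borel_measurable M"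
    using less by (intro borel_measurable_sum borel_measurable_times) auto
  then show ?case
    unfolding newton_sum.simps[where m = m] by measurable
qed

definition trunc_poly :: "(nat \<Rightarrow> complex) \<Rightarrow> nat \<Rightarrow> complex poly" where
  "trunc_poly a n = (\<Sum>k\<le>n. monom (a k) k)"

lemma coeff_trunc_poly: "coeff (trunc_poly a n) i = (if i \<le> n then a i else 0)"
  by (simp add: trunc_poly_def coeff_sum)

lemma poly_trunc_poly: "poly (trunc_poly a n) z = (\<Sum>k\<le>n. a k * z ^ k)"
  by (simp add: trunc_poly_def poly_sum poly_monom)

text \<open>Each factor of the decomposition into simple roots is normalised by X - z = -z (1 - X /
  z), possible because 0 is not a root. Evaluation at 0 identifies the accumulated scalar.\<close>

lemma rsquarefree_fps_prod:
  fixes p :: "complex poly"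
  assumes "rsquarefree p" "coeff p 0 \<noteq> 0"
  shows "fps_of_poly p = fps_const (coeff p 0) *
           (\<Prod>z | poly p z = 0. 1 - fps_const (1 / z) * fps_X)"
proof -
  let ?Z = "{z. poly p z = 0}"
  have nz: "z \<noteq> 0" if "z \<in> ?Z" for z
    using that assms(2) by (auto simp: poly_0_coeff_0)
  have "p = smult (lead_coeff p) (\<Prod>z\<in>?Z. [:-z, 1:])"
    using complex_poly_decompose_rsquarefree[OF assms(1)] by simp
  also have "(\<Prod>z\<in>?Z. [:-z, 1:]) = (\<Prod>z\<in>?Z. smult (-z) [:1, - (1 / z):])"
    using nz by (intro prod.cong) auto
  also have "\<dots> = smult (\<Prod>z\<in>?Z. -z) (\<Prod>z\<in>?Z. [:1, - (1 / z):])"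
    by (rule prod_smult)
  finally have p: "p = smult (lead_coeff p * (\<Prod>z\<in>?Z. -z)) (\<Prod>z\<in>?Z. [:1, - (1 / z):])"
    by simp
  have "coeff p 0 = lead_coeff p * (\<Prod>z\<in>?Z. -z)"
    by (subst p) (simp add: coeff_0_prod_list flip: poly_0_coeff_0, simp add: poly_prod)
  with p have "p = smult (coeff p 0) (\<Prod>z\<in>?Z. [:1, - (1 / z):])"
    by simp
  then have "fps_of_poly p = fps_const (coeff p 0) * (\<Prod>z\<in>?Z. fps_of_poly [:1, - (1 / z):])"
    by (metis fps_of_poly_smult fps_of_poly_prod)
  also have "(\<Prod>z\<in>?Z. fps_of_poly [:1, - (1 / z):]) = (\<Prod>z\<in>?Z. 1 - fps_const (1 / z) * fps_X)"
    by (intro prod.cong refl) (simp add: fps_of_poly_pCons fps_const_neg[symmetric] del: fps_const_neg)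
  finally show ?thesis .
qed

text \<open>The normalised product satisfies Newton's identities with w = 1/z. They are linear in
  the coefficients, so the factor p(0) does no harm.\<close>

lemma inverse_power_sum_eq_newton_sum:
  fixes p :: "complex poly"
  assumes "rsquarefree p" "coeff p 0 \<noteq> 0" "m \<ge> 1"
  shows "(\<Sum>z | poly p z = 0. 1 / z ^ m) = newton_sum (coeff p) m"
proof -
  let ?Z = "{z. poly p z = 0}"
  let ?E = "\<Prod>z\<in>?Z. 1 - fps_const (1 / z) * fps_X"
  have "p \<noteq> 0" using assms(2) by auto
  then have fin: "finite ?Z" by (rule poly_roots_finite)
  define c where "c = coeff p 0"
  have coeff: "coeff p i = c * fps_nth ?E i" for i
    using arg_cong[OF rsquarefree_fps_prod[OF assms(1,2)], of "\<lambda>f. fps_nth f i"] by (simp add: c_def)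
  have "newton_sum (coeff p) m = (\<Sum>z\<in>?Z. (1 / z) ^ m)"
  proof (rule newton_sum_unique)
    fix l
    have "of_nat (Suc l) * coeff p (Suc l) = c * (of_nat (Suc l) * fps_nth ?E (Suc l))"
      unfolding coeff by (rule mult.left_commute)
    also have "\<dots> = c * - (\<Sum>i\<le>l. fps_nth ?E i * (\<Sum>z\<in>?Z. (1 / z) ^ (Suc l - i)))"
      by (simp only: fps_nth_prod_linear_Suc[OF fin, where w = "\<lambda>z. 1 / z" and m = l])
    also have "\<dots> = - (\<Sum>i\<le>l. coeff p i * (\<Sum>z\<in>?Z. (1 / z) ^ (Suc l - i)))"
      unfolding coeff by (simp only: mult_minus_right sum_distrib_left[of c] mult.assoc)
    finally show "of_nat (Suc l) * coeff p (Suc l)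
      = - (\<Sum>i\<le>l. coeff p i * (\<Sum>z\<in>?Z. (1 / z) ^ (Suc l - i)))" .
  qed (use assms in auto)
  then show ?thesis by (simp add: power_divide)
qed

text \<open>Vieta's formula for the reciprocals of the zeros. Numbering the zeros by
  \<open>h\<close> gives the finite sequence to which the defining property of
  \<open>newton_poly\<close> applies.\<close>

lemma ratio_eq_newton_poly:
  fixes p :: "complex poly"
  assumes "rsquarefree p" "coeff p 0 \<noteq> 0"
  shows "coeff p k / coeff p 0
    = (-1) ^ k * eval_mpoly (newton_poly k) (\<lambda>m. \<Sum>z | poly p z = 0. 1 / z ^ m)"
proof -
  let ?Z = "{z. poly p z = 0}" and ?c = "coeff p 0"
  have "p \<noteq> 0" using assms(2) by auto
  then have "finite ?Z" by (rule poly_roots_finite)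
  then obtain h where h: "bij_betw h {1..card ?Z} ?Z"
    using ex_bij_betw_nat_finite_1 by blast
  have "fps_of_poly p = fps_const ?c * (\<Prod>j\<in>{1..card ?Z}. 1 - fps_const (1 / h j) * fps_X)"
    unfolding rsquarefree_fps_prod[OF assms] by (simp add: prod.reindex_bij_betw[OF h, symmetric])
  then have "coeff p k = ?c * ((-1) ^ k * elem_sym k (card ?Z) (\<lambda>j. 1 / h j))"
    using fps_nth_prod_linear_elem_sym[of "\<lambda>j. 1 / h j" "card ?Z" k]
    by (metis fps_mult_left_const_nth fps_of_poly_nth)
  moreover have "elem_sym k (card ?Z) (\<lambda>j. 1 / h j)
      = eval_mpoly (newton_poly k) (\<lambda>m. \<Sum>j=1..card ?Z. (1 / h j) ^ m)"
    using is_newton_poly_newton_poly unfolding is_newton_poly_def by blast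
  moreover have "(\<Sum>j=1..card ?Z. (1 / h j) ^ m) = (\<Sum>z\<in>?Z. 1 / z ^ m)" for m
    using sum.reindex_bij_betw[OF h, of "\<lambda>z. 1 / z ^ m"] by (simp add: power_divide)
  ultimately show ?thesis
    using assms(2) by simp
qed

section \<open>Almost sure simplicity of the zeros\<close>

text \<open>Projection along a compact factor is a closed map. It serves to eliminate the quantifier
  over possible multiple zeros.\<close>

lemma closed_compact_fst_projection:
  fixes S :: "('a :: topological_space \<times> 'b :: topological_space) set"
  assumes "compact K" "closed S"
  shows "closed {y. \<exists>x\<in>K. (x, y) \<in> S}"
proof -
  have "compact_space (top_of_set K)"
    using assms(1) by (simp add: compact_space_subtopology)
  then have "closed_map (prod_topology (top_of_set K) (euclidean :: 'b topology)) euclidean snd"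
    by (rule closed_map_snd)
  moreover have "closedin (prod_topology (top_of_set K) euclidean) (S \<inter> (K \<times> UNIV))"
  proof -
    have "prod_topology (top_of_set K) (euclidean :: 'b topology) = top_of_set (K \<times> UNIV)"
      by (simp add: prod_topology_subtopology(1))
    then show ?thesis
      using assms(2) by (metis Int_commute closedin_closed_Int)
  qed
  ultimately have "closed (snd ` (S \<inter> (K \<times> UNIV)))"
    unfolding closed_map_def closed_closedin by blast
  moreover have "snd ` (S \<inter> (K \<times> UNIV)) = {y. \<exists>x\<in>K. (x, y) \<in> S}"
    by force
  ultimately show ?thesis by simp
qed

lemma poly_pderiv_trunc_poly:
  "poly (pderiv (trunc_poly a n)) w = (\<Sum>k\<le>n. a k * (of_nat k * w ^ (k - 1)))"
proof -
  have "pderiv (trunc_poly a n) = (\<Sum>k\<le>n. monom (of_nat k * a k) (k - 1))"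
    unfolding trunc_poly_def by (induction n) (simp_all add: pderiv_add pderiv_monom del: of_nat_Suc)
  then show ?thesis
    by (simp add: poly_sum poly_monom mult.left_commute mult.assoc)
qed

text \<open>A multiple zero is a common zero of the polynomial and its derivative, a closed
  condition on pairs (w, a). Confining w to balls of integer radius makes each projection closed, so
  the bad set is a countable union of closed sets.\<close>

lemma rsquarefree_trunc_poly_borel:
  "{a. rsquarefree (trunc_poly a n)} \<in> sets borel"
proof -
  define S :: "(complex \<times> (nat \<Rightarrow> complex)) set"
    where "S = {(w, a). poly (trunc_poly a n) w = 0 \<and> poly (pderiv (trunc_poly a n)) w = 0}"
  have coord: "continuous_on UNIV (\<lambda>x :: complex \<times> (nat \<Rightarrow> complex). snd x k)" for k
    by (rule continuous_on_product_then_coordinatewise) (rule continuous_on_snd[OF continuous_on_id])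
  have "closed S"
    unfolding S_def case_prod_unfold poly_trunc_poly poly_pderiv_trunc_poly
    by (intro closed_Collect_conj closed_Collect_eq continuous_intros coord)
  then have "closed {a. \<exists>w\<in>cball 0 (real r). (w, a) \<in> S}" for r
    by (intro closed_compact_fst_projection) auto
  then have "(\<Union>r. {a. \<exists>w\<in>cball 0 (real r). (w, a) \<in> S}) \<in> sets borel"
    by (intro sets.countable_UN) auto
  moreover have "(\<Union>r. {a. \<exists>w\<in>cball 0 (real r). (w, a) \<in> S}) = - {a. rsquarefree (trunc_poly a n)}"
    by (auto simp: S_def rsquarefree_roots) (metis mem_cball_0 real_arch_simple)
  ultimately show ?thesis
    by (metis borel_comp double_complement)
qed

text \<open>
  The constant coefficients that produce a multiple zero are minus the critical values of the rest
  of the polynomial.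
\<close>

lemma finite_not_rsquarefree_trunc_poly:
  assumes "n > 0 \<Longrightarrow> a n \<noteq> 0"
  shows "finite {u. \<not> rsquarefree (trunc_poly (a(0 := u)) n)}"
proof -
  define q where "q = trunc_poly (a(0 := 0)) n"
  have split: "trunc_poly (a(0 := u)) n = q + [:u:]" for u
    by (auto simp: poly_eq_iff q_def coeff_trunc_poly coeff_pCons split: nat.split)
  show ?thesis
  proof (cases "n = 0")
    case True
    then have "q = 0"
      by (auto simp: poly_eq_iff q_def coeff_trunc_poly)
    \<comment> \<open>The polynomial is the constant \<open>u\<close>, and among constants only 0
      fails to be \<open>rsquarefree\<close>.\<close>
    then have "{u. \<not> rsquarefree (trunc_poly (a(0 := u)) n)} \<subseteq> {0}"
      by (auto simp: split rsquarefree_roots)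
    then show ?thesis
      by (rule finite_subset) simp
  next
    case False
    \<comment> \<open>The coefficient is n \<open>a n\<close>, so the derivative is not identically
      zero and there are finitely many critical points; adding \<open>u\<close> does not move
      them.\<close>
    then have "coeff (pderiv q) (n - 1) \<noteq> 0"
      using assms by (simp add: coeff_pderiv q_def coeff_trunc_poly)
    then have "pderiv q \<noteq> 0"
      by auto
    then have "finite ((\<lambda>w. - poly q w) ` {w. poly (pderiv q) w = 0})"
      by (intro finite_imageI poly_roots_finite)
    moreover have "{u. \<not> rsquarefree (trunc_poly (a(0 := u)) n)}
        \<subseteq> (\<lambda>w. - poly q w) ` {w. poly (pderiv q) w = 0}"
      by (auto simp: split rsquarefree_roots pderiv_add pderiv_pCons image_iff eq_neg_iff_add_eq_0
          add.commute)
    ultimately show ?thesis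
      by (rule finite_subset[rotated])
  qed
qed

text \<open>By independence the law of the sequence is the product of the law of coordinate 0 and
  that of the rest. Fubini then allows the rest to be fixed, and an atomless variable avoids the
  finitely many bad values.\<close>

lemma (in prob_space) AE_rsquarefree_trunc_poly:
  assumes indep: "indep_vars (\<lambda>_. borel) X UNIV"
    and atomless: "\<And>k c. AE \<omega> in M. X k \<omega> \<noteq> c"
  shows "AE \<omega> in M. rsquarefree (trunc_poly (\<lambda>k. X k \<omega>) n)"
proof -
  have [measurable]: "X k \<in> borel_measurable M" for k
    using indep by (simp add: indep_vars_def)
  define S :: "(nat \<Rightarrow> complex) measure" where "S = PiM (- {0}) (\<lambda>_. borel)"
  define V where "V = (\<lambda>\<omega>. restrict (\<lambda>i. X i \<omega>) (- {0}))"
  define T :: "(nat \<Rightarrow> complex) measure" where "T = PiM {0} (\<lambda>_. borel)"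
  define U where "U = (\<lambda>\<omega>. restrict (\<lambda>i. X i \<omega>) {0})"
  \<comment> \<open>\<open>f\<close> puts coordinate 0 back into the sequence, so that
    \<open>f\<close> applied to (\<open>V\<close>, \<open>U\<close>) is the original
    sequence.\<close>
  define f where "f = (\<lambda>(y :: nat \<Rightarrow> complex, t :: nat \<Rightarrow> complex). y(0 := t 0))"
  have "indep_var S V T U"
    unfolding S_def V_def T_def U_def by (rule indep_var_restrict[OF indep]) auto
  then have V[measurable]: "V \<in> M \<rightarrow>\<^sub>M S"
    and U[measurable]: "U \<in> M \<rightarrow>\<^sub>M T"
    and dist: "distr M S V \<Otimes>\<^sub>M distr M T U = distr M (S \<Otimes>\<^sub>M T) (\<lambda>\<omega>. (V \<omega>, U \<omega>))"
    unfolding indep_var_distribution_eq by auto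
  have [measurable]: "(\<lambda>t. t 0) \<in> borel_measurable T"
    unfolding T_def by (intro measurable_component_singleton) simp
  have "f \<in> S \<Otimes>\<^sub>M T \<rightarrow>\<^sub>M PiM UNIV (\<lambda>_. borel)"
    unfolding f_def case_prod_unfold
    by (rule measurable_fun_upd[where J = "- {0}"]) (auto simp: S_def[symmetric])
  \<comment> \<open>The product sigma-algebra is the Borel sigma-algebra of the product topology, in
    which the square-free set was shown to lie.\<close>
  then have f[measurable]: "f \<in> S \<Otimes>\<^sub>M T \<rightarrow>\<^sub>M borel"
    using measurable_cong_sets[OF refl sets_PiM_equal_borel] by blast
  have [measurable]: "Measurable.pred borel (\<lambda>a. rsquarefree (trunc_poly a n))"
    using rsquarefree_trunc_poly_borel by (simp add: pred_def)
  interpret V: prob_space "distr M S V"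
    by (rule prob_space_distr) measurable
  interpret U: prob_space "distr M T U"
    by (rule prob_space_distr) measurable
  interpret pair_sigma_finite "distr M S V" "distr M T U" ..
  have "AE z in distr M S V \<Otimes>\<^sub>M distr M T U. rsquarefree (trunc_poly (f z) n)"
  proof (rule AE_pair_measure)
    show "{z \<in> space (distr M S V \<Otimes>\<^sub>M distr M T U). rsquarefree (trunc_poly (f z) n)}
        \<in> sets (distr M S V \<Otimes>\<^sub>M distr M T U)"
      by measurable
    \<comment> \<open>For n > 0 the top coefficient belongs to the part held fixed, and almost
      surely it does not vanish.\<close>
    have "AE y in distr M S V. n > 0 \<longrightarrow> y n \<noteq> 0"
    proof (cases "n = 0")
      case False
      then have [measurable]: "(\<lambda>y. y n) \<in> borel_measurable S"
        unfolding S_def by (intro measurable_component_singleton) simp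
      show ?thesis
        using False atomless[of n 0] by (subst AE_distr_iff[OF V]) (auto simp: V_def)
    qed simp
    then show "AE y in distr M S V. AE t in distr M T U. rsquarefree (trunc_poly (f (y, t)) n)"
    proof eventually_elim
      case (elim y)
      let ?B = "{u. \<not> rsquarefree (trunc_poly (y(0 := u)) n)}"
      have "countable ?B"
        using elim by (intro countable_finite finite_not_rsquarefree_trunc_poly) auto
      moreover have "AE t in distr M T U. t 0 \<noteq> c" for c
        using atomless[of 0 c] by (subst AE_distr_iff[OF U]) (auto simp: U_def)
      ultimately have "AE t in distr M T U. \<forall>c\<in>?B. t 0 \<noteq> c"
        by (intro AE_ball_countable') auto
      then show ?case
        by eventually_elim (auto simp: f_def)
    qed
  qed
  then have "AE \<omega> in M. rsquarefree (trunc_poly (f (V \<omega>, U \<omega>)) n)"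
    unfolding dist by (subst (asm) AE_distr_iff) auto
  moreover have "f (V \<omega>, U \<omega>) = (\<lambda>k. X k \<omega>)" for \<omega>
    by (auto simp: f_def V_def U_def)
  ultimately show ?thesis
    by simp
qed

section \<open>Limits in probability and the completed space\<close>

text \<open>Preimages under \<open>f\<close> and \<open>g\<close> differ by null sets, which the
  completion contains. It applies to sums over the zero set, which are known to agree with a
  measurable function only almost everywhere.\<close>

lemma measurable_completion_AE_eq:
  assumes g: "g \<in> M \<rightarrow>\<^sub>M N" and eq: "AE x in M. f x = g x"
    and f: "\<And>x. x \<in> space M \<Longrightarrow> f x \<in> space N"
  shows "f \<in> completion M \<rightarrow>\<^sub>M N"
proof (rule measurableI)
  fix A assume "A \<in> sets N"
  then have A: "g -` A \<inter> space M \<in> sets (completion M)"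
    using g by (auto intro: measurable_sets)
  have "AE x in completion M. x \<in> g -` A \<inter> space M \<longleftrightarrow> x \<in> f -` A \<inter> space (completion M)"
    using AE_completion[OF eq] by eventually_elim auto
  then show "f -` A \<inter> space (completion M) \<in> sets (completion M)"
    by (rule completion.in_sets_AE[OF _ A]) auto
qed (use f in auto)

text \<open>\<open>lim_in_prob\<close> picks an unspecified version. \<open>Y\<close> is one limit,
  so the choice yields a genuine limit, and limits in probability are almost surely unique.\<close>

lemma (in prob_space) lim_in_prob_eventually_const:
  assumes X: "\<And>n. X n \<in> borel_measurable M" and Y: "Y \<in> borel_measurable M"
    and eq: "\<And>n. n \<ge> k \<Longrightarrow> AE \<omega> in M. X n \<omega> = Y \<omega>"
  shows "AE \<omega> in M. lim_in_prob M X \<omega> = Y \<omega>"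
proof -
  define Z where "Z = lim_in_prob M X"
  have "tendsto_in_prob M X Y"
    unfolding tendsto_in_prob_def
  proof (intro conjI allI impI)
    fix \<epsilon> :: real assume "\<epsilon> > 0"
    have "prob {\<omega> \<in> space M. dist (X n \<omega>) (Y \<omega>) > \<epsilon>} = 0" if "n \<ge> k" for n
      using eq[OF that] \<open>\<epsilon> > 0\<close> by (intro prob_eq_0_AE) (auto elim: eventually_mono)
    then have "eventually (\<lambda>n. prob {\<omega> \<in> space M. dist (X n \<omega>) (Y \<omega>) > \<epsilon>} = 0) sequentially"
      unfolding eventually_sequentially by blast
    then show "(\<lambda>n. prob {\<omega> \<in> space M. dist (X n \<omega>) (Y \<omega>) > \<epsilon>}) \<longlonglongrightarrow> 0"
      by (rule tendsto_eventually)
  qed (use X Y in auto)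
  then have "tendsto_in_prob M X Z"
    unfolding Z_def lim_in_prob_def by (rule someI[of "tendsto_in_prob M X"])
  then have Z[measurable]: "Z \<in> borel_measurable M"
    and lim: "\<And>\<epsilon>. \<epsilon> > 0 \<Longrightarrow> (\<lambda>n. prob {\<omega> \<in> space M. dist (X n \<omega>) (Z \<omega>) > \<epsilon>}) \<longlonglongrightarrow> 0"
    unfolding tendsto_in_prob_def by auto
  note [measurable] = X Y
  have "AE \<omega> in M. dist (Y \<omega>) (Z \<omega>) \<le> 1 / Suc m" for m
  proof -
    let ?e = "1 / real (Suc m)"
    \<comment> \<open>From k on, these probabilities do not depend on n; as they tend to 0, their
      common value is 0.\<close>
    have "prob {\<omega> \<in> space M. dist (X n \<omega>) (Z \<omega>) > ?e} = prob {\<omega> \<in> space M. dist (Y \<omega>) (Z \<omega>) > ?e}"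
      if "n \<ge> k" for n
      using eq[OF that] by (intro prob_eq_AE) (auto elim: eventually_mono)
    then have "eventually (\<lambda>n. prob {\<omega> \<in> space M. dist (X n \<omega>) (Z \<omega>) > ?e}
        = prob {\<omega> \<in> space M. dist (Y \<omega>) (Z \<omega>) > ?e}) sequentially"
      unfolding eventually_sequentially by blast
    then have "(\<lambda>n. prob {\<omega> \<in> space M. dist (X n \<omega>) (Z \<omega>) > ?e})
        \<longlonglongrightarrow> prob {\<omega> \<in> space M. dist (Y \<omega>) (Z \<omega>) > ?e}"
      by (rule tendsto_eventually)
    with lim[of ?e] have "prob {\<omega> \<in> space M. dist (Y \<omega>) (Z \<omega>) > ?e} = 0"
      using LIMSEQ_unique by fastforce
    then have "AE \<omega> in M. \<omega> \<notin> {\<omega> \<in> space M. dist (Y \<omega>) (Z \<omega>) > ?e}"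
      by (subst (asm) prob_eq_0) auto
    with AE_space show ?thesis
      by eventually_elim auto
  qed
  then have "AE \<omega> in M. \<forall>m. dist (Y \<omega>) (Z \<omega>) \<le> 1 / Suc m"
    by (simp add: AE_all_countable)
  then show ?thesis
    unfolding Z_def[symmetric]
  proof eventually_elim
    case (elim \<omega>)
    then have "\<not> dist (Y \<omega>) (Z \<omega>) > 0"
      using nat_approx_posE by (metis not_le)
    then show ?case by simp
  qed
qed

section \<open>The Gaussian coefficients\<close>

lemma (in prob_space) std_complex_gaussian_AE_neq:
  assumes "std_complex_gaussian M X"
  shows "AE \<omega> in M. X \<omega> \<noteq> c"
proof -
  have "distributed M lborel X (\<lambda>z. ennreal (exp (- (cmod z)\<^sup>2) / pi))"
    using assms by (simp add: std_complex_gaussian_def)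
  from distributed_AE2[OF this, of "\<lambda>z. z \<noteq> c"] show ?thesis
    using AE_lborel_singleton[of c] by (auto elim: eventually_mono)
qed

theorem proposition12p1:
  fixes M :: "'a measure" and \<xi> :: "nat \<Rightarrow> 'a \<Rightarrow> complex"
  assumes "prob_space M"
    and "prob_space.indep_vars M (\<lambda>_. borel) \<xi> UNIV"
    and "\<And>k. std_complex_gaussian M (\<xi> k)"
  shows "AE \<omega> in M. \<forall>k\<ge>1.
           1 / of_real (sqrt (fact k)) * (\<xi> k \<omega> / \<xi> 0 \<omega>)
             = (-1) ^ k * eval_mpoly (newton_poly k) (\<lambda>i. gaf_alpha M \<xi> i \<omega>)"
proof -
  interpret prob_space M by fact
  interpret C: prob_space "completion M" by (rule prob_space_completion)
  \<comment> \<open>The weights 1/sqrt(k!) are absorbed into the coefficients, which stay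
    independent and atomless.\<close>
  define a where "a = (\<lambda>k \<omega>. \<xi> k \<omega> / complex_of_real (sqrt (fact k)))"
  let ?p = "\<lambda>n \<omega>. trunc_poly (\<lambda>k. a k \<omega>) n"
  have indep: "indep_vars (\<lambda>_. borel) a UNIV"
    unfolding a_def by (rule indep_vars_compose2[OF assms(2)]) simp
  then have a_meas[measurable]: "a k \<in> borel_measurable M" for k
    by (simp add: indep_vars_def)
  have atomless: "AE \<omega> in M. a k \<omega> \<noteq> c" for k c
    using std_complex_gaussian_AE_neq[OF assms(3), of k "c * complex_of_real (sqrt (fact k))"]
    by eventually_elim (auto simp: a_def)
  have good: "AE \<omega> in M. a 0 \<omega> \<noteq> 0 \<and> (\<forall>n. rsquarefree (?p n \<omega>))"
    using AE_rsquarefree_trunc_poly[OF indep atomless] atomless[of 0 0]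
    by (simp add: AE_all_countable)
  have ips: "inv_power_sum (\<lambda>j. \<xi> j \<omega>) n k = (\<Sum>z | poly (?p n \<omega>) z = 0. 1 / z ^ k)" for \<omega> n k
    by (simp add: inv_power_sum_def gaf_zeros_def gaf_trunc_def poly_trunc_poly a_def)
  have ips_newton: "AE \<omega> in M. inv_power_sum (\<lambda>j. \<xi> j \<omega>) n k = newton_sum (coeff (?p n \<omega>)) k"
    if "k \<ge> 1" for n k
    using good
    by eventually_elim
      (use that in \<open>auto simp: ips coeff_trunc_poly intro!: inverse_power_sum_eq_newton_sum\<close>)
  have newton_sum_trunc: "newton_sum (coeff (?p n \<omega>)) k = newton_sum (\<lambda>i. a i \<omega>) k"
    if "n \<ge> k" for n k \<omega>
    by (rule newton_sum_cong) (use that in \<open>simp add: coeff_trunc_poly\<close>)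
  have alpha: "AE \<omega> in M. gaf_alpha M \<xi> k \<omega> = newton_sum (\<lambda>i. a i \<omega>) k" if "k \<ge> 1" for k
  proof -
    have "AE \<omega> in completion M. gaf_alpha M \<xi> k \<omega> = newton_sum (\<lambda>i. a i \<omega>) k"
      unfolding gaf_alpha_def
    proof (rule C.lim_in_prob_eventually_const[where k = k])
      fix n
      \<comment> \<open>On \<open>M\<close> itself only this expression in the coefficients is shown
        measurable; its almost sure equality with the inverse power sum gives measurability on the
        completion.\<close>
      have "(\<lambda>\<omega>. newton_sum (\<lambda>i. coeff (?p n \<omega>) i) k) \<in> borel_measurable M"
        by (intro measurable_newton_sum) (simp add: coeff_trunc_poly)
      then show "(\<lambda>\<omega>. inv_power_sum (\<lambda>j. \<xi> j \<omega>) n k) \<in> borel_measurable (completion M)"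
        using ips_newton[OF that] by (rule measurable_completion_AE_eq) simp
    next
      show "(\<lambda>\<omega>. newton_sum (\<lambda>i. a i \<omega>) k) \<in> borel_measurable (completion M)"
        by (intro measurable_completion measurable_newton_sum a_meas)
    next
      fix n assume "k \<le> n"
      then show "AE \<omega> in completion M. inv_power_sum (\<lambda>j. \<xi> j \<omega>) n k = newton_sum (\<lambda>i. a i \<omega>) k"
        using AE_completion[OF ips_newton[OF that, of n]] by (simp add: newton_sum_trunc)
    qed
    then show ?thesis
      by (simp add: AE_completion_iff)
  qed
  have "AE \<omega> in M. \<forall>k\<in>{1..}. gaf_alpha M \<xi> k \<omega> = newton_sum (\<lambda>i. a i \<omega>) k"
    using alpha by (intro AE_ball_countable') auto
  with good show ?thesis
  proof (eventually_elim, intro allI impI)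
    fix \<omega> and k :: nat
    assume good: "a 0 \<omega> \<noteq> 0 \<and> (\<forall>n. rsquarefree (?p n \<omega>))" and k: "k \<ge> 1"
      and alpha: "\<forall>k\<in>{1..}. gaf_alpha M \<xi> k \<omega> = newton_sum (\<lambda>i. a i \<omega>) k"
    \<comment> \<open>The truncation of degree k suffices, since it already contains the
      coefficients 0 and k; sqrt(0!) = 1 gives \<open>a 0\<close> = \<xi> 0.\<close>
    have "1 / of_real (sqrt (fact k)) * (\<xi> k \<omega> / \<xi> 0 \<omega>) = coeff (?p k \<omega>) k / coeff (?p k \<omega>) 0"
      by (simp add: coeff_trunc_poly a_def)
    also have "\<dots> = (-1) ^ k * eval_mpoly (newton_poly k) (\<lambda>m. \<Sum>z | poly (?p k \<omega>) z = 0. 1 / z ^ m)"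
      using good by (intro ratio_eq_newton_poly) (auto simp: coeff_trunc_poly)
    also have "eval_mpoly (newton_poly k) (\<lambda>m. \<Sum>z | poly (?p k \<omega>) z = 0. 1 / z ^ m)
        = eval_mpoly (newton_poly k) (\<lambda>i. gaf_alpha M \<xi> i \<omega>)"
    \<comment> \<open>Only variables of index 1, ..., k occur in \<open>newton_poly k\<close>. The
      lower bound excludes the order 0 sum, which counts zeros; the upper bound ensures that the
      inverse power sums of this truncation have reached their limits.\<close>
    proof (rule eval_mpoly_cong)
      fix m i
      assume "m \<in> Poly_Mapping.keys (newton_poly k)" "i \<in> Poly_Mapping.keys m"
      then have i: "i \<in> {1..k}"
        using is_newton_poly_newton_poly[of k] unfolding is_newton_poly_def by blast
      then have "(\<Sum>z | poly (?p k \<omega>) z = 0. 1 / z ^ i) = newton_sum (coeff (?p k \<omega>)) i"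
        using good by (intro inverse_power_sum_eq_newton_sum) (auto simp: coeff_trunc_poly)
      then show "(\<Sum>z | poly (?p k \<omega>) z = 0. 1 / z ^ i) = gaf_alpha M \<xi> i \<omega>"
        using i alpha by (simp add: newton_sum_trunc)
    qed
    finally show "1 / of_real (sqrt (fact k)) * (\<xi> k \<omega> / \<xi> 0 \<omega>)
      = (-1) ^ k * eval_mpoly (newton_poly k) (\<lambda>i. gaf_alpha M \<xi> i \<omega>)" .
  qed
qed

end
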